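(* For $n\geq 5$, $\mathrm{rank}(\mathsf{Z}_{1})=\mathrm{rank}(\mathsf{Z}_{n})=2n-5$.
   Context: For a positive integer $n$, let $X_n=\{1<2<\cdots<n\}$ and let $\mathcal{O}_n$ be the semigroup of all order-preserving maps $\alpha: X_n\to X_n$ (i.e. $x<y$ implies $x\alpha\leq y\alpha$) under composition. Maps are written on the right and composed left to right: $x(\alpha\beta)=(x\alpha)\beta$. For $1\leq k\leq n$, $\pi_k\in\mathcal{O}_n$ is the constant map $x\pi_k=k$ for all $x\in X_n$, and $$\mathsf{Z}_{k} = \{ \alpha \in \mathcal{O}_{n} : \alpha \beta =\pi_{k}= \gamma \alpha \text{ for some }\beta, \gamma \in \mathcal{O}_{n}\setminus\{\pi_k\} \}.$$ The sets $\mathsf{Z}_1$ and $\mathsf{Z}_n$ are subsemigroups of $\mathcal{O}_n$. For a semigroup $S$, $\langle A\rangle$ denotes the smallest subsemigroup of $S$ containing the non-empty subset $A$, and $\mathrm{rank}(S)=\min\{\lvert A\rvert : S=\langle A\rangle\}$. *)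

theory Defs
  imports "HOL.Hull" "HOL-Library.FuncSet"
begin

text \<open>
  A semigroup is given by a carrier \<open>S\<close> and a binary operation \<open>f\<close>.
\<close>

definition subsemigroup :: "('a \<Rightarrow> 'a \<Rightarrow> 'a) \<Rightarrow> 'a set \<Rightarrow> 'a set \<Rightarrow> bool" where
  "subsemigroup f S T \<longleftrightarrow> T \<noteq> {} \<and> T \<subseteq> S \<and> (\<forall>x\<in>T. \<forall>y\<in>T. f x y \<in> T)"

definition generated_subsemigroup :: "('a \<Rightarrow> 'a \<Rightarrow> 'a) \<Rightarrow> 'a set \<Rightarrow> 'a set \<Rightarrow> 'a set" where
  "generated_subsemigroup f S A = subsemigroup f S hull A"

text \<open>
  Only finite generating sets are considered because \<^const>\<open>card\<close> is 0 on infinite sets; the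
  value is therefore meaningful for finitely generated \<open>S\<close> only, in particular for finite \<open>S\<close>.
\<close>

definition semigroup_rank :: "('a \<Rightarrow> 'a \<Rightarrow> 'a) \<Rightarrow> 'a set \<Rightarrow> nat" where
  "semigroup_rank f S =
     Inf {card A | A. A \<noteq> {} \<and> A \<subseteq> S \<and> finite A \<and> S = generated_subsemigroup f S A}"

text \<open>
  Self-maps of \<open>{1..n}\<close> are extensional functions (\<^const>\<open>undefined\<close> outside \<open>{1..n}\<close>), so
  that equality of functions is equality of maps.
\<close>

definition order_preserving_maps :: "nat \<Rightarrow> (nat \<Rightarrow> nat) set" where
  "order_preserving_maps n = {\<alpha> \<in> {1..n} \<rightarrow>\<^sub>E {1..n}. mono_on {1..n} \<alpha>}"

text \<open>Maps act on the right, so the product \<open>\<alpha> \<beta>\<close> applies \<open>\<alpha>\<close> first.\<close>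

definition map_mult :: "nat \<Rightarrow> (nat \<Rightarrow> nat) \<Rightarrow> (nat \<Rightarrow> nat) \<Rightarrow> (nat \<Rightarrow> nat)" where
  "map_mult n \<alpha> \<beta> = compose {1..n} \<beta> \<alpha>"

definition const_map :: "nat \<Rightarrow> nat \<Rightarrow> (nat \<Rightarrow> nat)" where
  "const_map n k = (\<lambda>x\<in>{1..n}. k)"

definition Z :: "nat \<Rightarrow> nat \<Rightarrow> (nat \<Rightarrow> nat) set" where
  "Z n k = {\<alpha> \<in> order_preserving_maps n.
     \<exists>\<beta> \<in> order_preserving_maps n - {const_map n k}.
     \<exists>\<gamma> \<in> order_preserving_maps n - {const_map n k}.
       map_mult n \<alpha> \<beta> = const_map n k \<and> map_mult n \<gamma> \<alpha> = const_map n k}"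

lemma map_mult_closed:
  assumes "\<alpha> \<in> order_preserving_maps n" "\<beta> \<in> order_preserving_maps n"
  shows "map_mult n \<alpha> \<beta> \<in> order_preserving_maps n"
proof -
  have a: "\<alpha> x \<in> {1..n}" "\<beta> x \<in> {1..n}" if "x \<in> {1..n}" for x
    using assms that unfolding order_preserving_maps_def by blast+
  have "mono_on {1..n} (compose {1..n} \<beta> \<alpha>)"
    using assms a unfolding order_preserving_maps_def
    by (auto simp: mono_on_def compose_def)
  moreover have "compose {1..n} \<beta> \<alpha> \<in> {1..n} \<rightarrow>\<^sub>E {1..n}"
    using a by (auto simp: compose_def)
  ultimately show ?thesis
    by (simp add: order_preserving_maps_def map_mult_def)
qed

lemma map_mult_assoc:
  assumes "\<alpha> \<in> order_preserving_maps n"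
  shows "map_mult n (map_mult n \<alpha> \<beta>) \<gamma> = map_mult n \<alpha> (map_mult n \<beta> \<gamma>)"
  using assms unfolding order_preserving_maps_def map_mult_def
  by (auto intro!: compose_assoc)

lemma map_mult_const_map_right:
  assumes "\<alpha> \<in> order_preserving_maps n"
  shows "map_mult n \<alpha> (const_map n k) = const_map n k"
  using assms unfolding order_preserving_maps_def map_mult_def const_map_def compose_def
  by (auto simp: fun_eq_iff)

lemma map_mult_const_map_left:
  assumes "\<alpha> k = k" "k \<in> {1..n}"
  shows "map_mult n (const_map n k) \<alpha> = const_map n k"
  using assms unfolding map_mult_def const_map_def compose_def
  by (auto simp: fun_eq_iff)

lemma Z_fixes:
  assumes "\<alpha> \<in> Z n k" "k = 1 \<or> k = n" "n \<ge> 1"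
  shows "\<alpha> k = k"
proof -
  from assms(1) obtain \<gamma> where \<alpha>: "\<alpha> \<in> order_preserving_maps n"
    and \<gamma>: "\<gamma> \<in> order_preserving_maps n" "map_mult n \<gamma> \<alpha> = const_map n k"
    unfolding Z_def by auto
  have k: "k \<in> {1..n}" using assms by auto
  have in_range: "\<gamma> k \<in> {1..n}" "\<alpha> k \<in> {1..n}"
    using \<alpha> \<gamma> k unfolding order_preserving_maps_def by blast+
  have hit: "\<alpha> (\<gamma> k) = k"
    using fun_cong[OF \<gamma>(2), of k] k by (simp add: map_mult_def const_map_def compose_def)
  have mono: "\<alpha> x \<le> \<alpha> y" if "x \<in> {1..n}" "y \<in> {1..n}" "x \<le> y" for x y
    using \<alpha> that unfolding order_preserving_maps_def mono_on_def by blast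
  from assms(2) show ?thesis
  proof
    assume "k = 1"
    then show ?thesis using mono[of k "\<gamma> k"] k in_range hit by auto
  next
    assume "k = n"
    then show ?thesis using mono[of "\<gamma> k" k] k in_range hit by auto
  qed
qed

lemma Z_mult_closed:
  assumes "k = 1 \<or> k = n" "n \<ge> 1" "\<alpha> \<in> Z n k" "\<alpha>' \<in> Z n k"
  shows "map_mult n \<alpha> \<alpha>' \<in> Z n k"
proof -
  let ?O = "order_preserving_maps n - {const_map n k}"
  obtain \<gamma> where \<gamma>: "\<gamma> \<in> ?O" "map_mult n \<gamma> \<alpha> = const_map n k"
    using assms(3) unfolding Z_def by auto
  obtain \<beta> where \<beta>: "\<beta> \<in> ?O" "map_mult n \<alpha>' \<beta> = const_map n k"
    using assms(4) unfolding Z_def by auto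
  have o: "\<alpha> \<in> order_preserving_maps n" "\<alpha>' \<in> order_preserving_maps n"
    using assms unfolding Z_def by auto
  have "map_mult n (map_mult n \<alpha> \<alpha>') \<beta> = const_map n k"
    using o \<beta> by (simp add: map_mult_assoc map_mult_const_map_right)
  moreover have "map_mult n \<gamma> (map_mult n \<alpha> \<alpha>') = map_mult n (map_mult n \<gamma> \<alpha>) \<alpha>'"
    using \<gamma>(1) by (simp add: map_mult_assoc)
  then have "map_mult n \<gamma> (map_mult n \<alpha> \<alpha>') = const_map n k"
    using \<gamma>(2) map_mult_const_map_left[of \<alpha>' k n] Z_fixes[OF assms(4,1,2)] assms(1,2) by auto
  ultimately show ?thesis
    using \<beta>(1) \<gamma>(1) map_mult_closed[OF o] unfolding Z_def by blast
qed

lemma const_map_in_Z: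
  assumes "k \<in> {1..n}" "n \<ge> 2"
  shows "const_map n k \<in> Z n k"
proof -
  let ?id = "\<lambda>x\<in>{1..n}. x"
  have c: "const_map n k \<in> order_preserving_maps n"
    using assms by (auto simp: order_preserving_maps_def const_map_def mono_on_def)
  have "?id \<in> order_preserving_maps n"
    by (auto simp: order_preserving_maps_def mono_on_def)
  moreover have "?id \<noteq> const_map n k"
  proof
    assume "?id = const_map n k"
    from fun_cong[OF this, of 1] fun_cong[OF this, of n] show False
      using assms(2) by (simp add: const_map_def)
  qed
  moreover have "map_mult n (const_map n k) ?id = const_map n k"
    "map_mult n ?id (const_map n k) = const_map n k"
    using assms by (auto simp: map_mult_def const_map_def compose_def fun_eq_iff)
  ultimately show ?thesis
    using c unfolding Z_def by blast
qed

lemma subsemigroup_Z: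
  assumes "k = 1 \<or> k = n" "n \<ge> 2"
  shows "subsemigroup (map_mult n) (order_preserving_maps n) (Z n k)"
proof -
  have "const_map n k \<in> Z n k" using assms by (auto intro: const_map_in_Z)
  moreover have "Z n k \<subseteq> order_preserving_maps n" unfolding Z_def by blast
  ultimately show ?thesis
    using assms Z_mult_closed[of k n] unfolding subsemigroup_def by auto
qed

end

theory Submission
  imports Defs
begin

text \<open>
  Conjugation by the order reversal \<open>x \<mapsto> n + 1 - x\<close> is an isomorphism between \<open>Z n 1\<close> and
  \<open>Z n n\<close>, so only \<open>Z n 1\<close> has to be treated. The annihilation conditions there are concrete: an
  order-preserving map belongs to \<open>Z n 1\<close> iff it sends both \<open>1\<close> and \<open>2\<close> to \<open>1\<close> and misses \<open>n\<close>
  (lemma \<open>Z_1_iff\<close>).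

  \<^bold>\<open>Lower bound.\<close> In a product \<open>\<beta> \<gamma>\<close> both factors identify \<open>1\<close> with \<open>2\<close>, and neither image contains \<open>n\<close>. A product with a large image therefore leaves almost no
  room for its factors. There are three kinds of maps \<open>g\<close> for which \<open>g = \<beta> \<gamma>\<close> forces \<open>\<beta> = g\<close> or
  \<open>\<gamma> = g\<close>: the only map of rank \<open>n - 1\<close> (\<open>ramp n 2\<close>), the maps of rank \<open>n - 2\<close> that fix \<open>3\<close> and
  miss only \<open>2\<close> and \<open>n\<close> (\<open>fuse\<close>), and the maps of rank \<open>n - 2\<close> that identify \<open>n - 1\<close> with \<open>n\<close> and
  miss only \<open>n\<close> and some \<open>c\<close> with \<open>3 \<le> c \<le> n - 2\<close> (\<open>skip\<close>). For such \<open>g\<close> the complement of \<open>g\<close> is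
  closed under products, so \<open>g\<close> is in every generating set. These are
  \<open>1 + (n - 3) + (n - 4) = 2 n - 6\<close> maps, and all of them send \<open>3\<close> to at most \<open>3\<close>. That property is
  inherited by products but fails for \<open>ramp n 4\<close>, so one further generator is needed.

  \<^bold>\<open>Upper bound.\<close> Adding \<open>ramp n 4\<close> is enough. Its powers are the maps \<open>ramp n t\<close> with \<open>t \<ge> 4\<close>.
  A map that is not of the form \<open>ramp n t\<close> with \<open>2 \<le> t \<le> n - 1\<close> is the product, in one order or the
  other, of an indispensable map and a different map that is pointwise at least as large
  (lemma \<open>larger_factor\<close>); as values are bounded by \<open>n - 1\<close>, repeating this ends at the maps
  \<open>ramp n t\<close>, and \<open>ramp n 2\<close> and \<open>ramp n 3 = fuse n (n - 1)\<close> are indispensable themselves.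
\<close>

section \<open>Generating sets and rank\<close>

lemma generated_eq_iff:
  assumes S: "subsemigroup f S S" and A: "A \<noteq> {}" "A \<subseteq> S"
  shows "S = generated_subsemigroup f S A \<longleftrightarrow>
    (\<forall>T. A \<subseteq> T \<longrightarrow> T \<subseteq> S \<longrightarrow> (\<forall>x\<in>T. \<forall>y\<in>T. f x y \<in> T) \<longrightarrow> T = S)"
    (is "_ \<longleftrightarrow> ?R")
proof
  assume eq: "S = generated_subsemigroup f S A"
  show ?R
  proof (intro allI impI)
    fix T assume T: "A \<subseteq> T" "T \<subseteq> S" "\<forall>x\<in>T. \<forall>y\<in>T. f x y \<in> T"
    then have "subsemigroup f S T" using A by (auto simp: subsemigroup_def)
    then have "S \<subseteq> T"
      using hull_minimal[of A T "subsemigroup f S"] T eq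
      by (simp add: generated_subsemigroup_def)
    then show "T = S" using T by auto
  qed
next
  assume R: ?R
  have "generated_subsemigroup f S A \<subseteq> S"
    using hull_minimal[of A S "subsemigroup f S"] S A by (simp add: generated_subsemigroup_def)
  moreover have "S \<subseteq> generated_subsemigroup f S A"
    unfolding generated_subsemigroup_def hull_def
  proof (rule Inter_greatest)
    fix T assume "T \<in> {T. subsemigroup f S T \<and> A \<subseteq> T}"
    then have "T = S" using R by (simp add: subsemigroup_def)
    then show "S \<subseteq> T" by simp
  qed
  ultimately show "S = generated_subsemigroup f S A" by simp
qed

text \<open>
  The preimage under \<open>\<phi>\<close> of a subsemigroup that contains \<open>\<phi> ` A\<close> is a subsemigroup that contains
  \<open>A\<close>, hence everything.
\<close>
lemma isomorphic_generating_card: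
  assumes S: "subsemigroup f S S" and S': "subsemigroup g S' S'"
    and bij: "bij_betw \<phi> S S'"
    and hom: "\<And>x y. x \<in> S \<Longrightarrow> y \<in> S \<Longrightarrow> \<phi> (f x y) = g (\<phi> x) (\<phi> y)"
    and A: "A \<noteq> {}" "A \<subseteq> S" "finite A" "S = generated_subsemigroup f S A"
  shows "\<exists>B. card A = card B \<and> B \<noteq> {} \<and> B \<subseteq> S' \<and> finite B \<and>
    S' = generated_subsemigroup g S' B"
proof (intro exI[of _ "\<phi> ` A"] conjI)
  have inj: "inj_on \<phi> S" and im: "\<phi> ` S = S'" using bij by (auto simp: bij_betw_def)
  show "card A = card (\<phi> ` A)" using inj A by (metis card_image inj_on_subset)
  show "\<phi> ` A \<noteq> {}" "finite (\<phi> ` A)" using A by auto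
  show sub: "\<phi> ` A \<subseteq> S'" using A im by auto
  show "S' = generated_subsemigroup g S' (\<phi> ` A)"
    unfolding generated_eq_iff[OF S' \<open>\<phi> ` A \<noteq> {}\<close> sub]
  proof (intro allI impI)
    fix T assume T: "\<phi> ` A \<subseteq> T" "T \<subseteq> S'" "\<forall>x\<in>T. \<forall>y\<in>T. g x y \<in> T"
    let ?U = "{x \<in> S. \<phi> x \<in> T}"
    have "\<forall>x\<in>?U. \<forall>y\<in>?U. f x y \<in> ?U"
      using T(3) hom S by (auto simp: subsemigroup_def)
    moreover have "A \<subseteq> ?U" using A T by auto
    ultimately have "?U = S"
      using A(4) unfolding generated_eq_iff[OF S A(1,2)] by blast
    then show "T = S'" using im T(2) by blast
  qed
qed

lemma semigroup_rank_isomorphic: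
  assumes S: "subsemigroup f S S" and S': "subsemigroup g S' S'"
    and bij: "bij_betw \<phi> S S'"
    and hom: "\<And>x y. x \<in> S \<Longrightarrow> y \<in> S \<Longrightarrow> \<phi> (f x y) = g (\<phi> x) (\<phi> y)"
  shows "semigroup_rank f S = semigroup_rank g S'"
proof -
  let ?\<psi> = "the_inv_into S \<phi>"
  have inj: "inj_on \<phi> S" and im: "\<phi> ` S = S'" using bij by (auto simp: bij_betw_def)
  have inv: "?\<psi> (g x y) = f (?\<psi> x) (?\<psi> y)" if xy: "x \<in> S'" "y \<in> S'" for x y
  proof -
    obtain u v where "u \<in> S" "v \<in> S" "x = \<phi> u" "y = \<phi> v"
      using xy unfolding im[symmetric] by blast
    moreover have "f u v \<in> S" using \<open>u \<in> S\<close> \<open>v \<in> S\<close> S by (simp add: subsemigroup_def)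
    ultimately show ?thesis
      using hom[of u v] by (metis the_inv_into_f_f[OF inj])
  qed
  have "{card A |A. A \<noteq> {} \<and> A \<subseteq> S \<and> finite A \<and> S = generated_subsemigroup f S A} =
    {card B |B. B \<noteq> {} \<and> B \<subseteq> S' \<and> finite B \<and> S' = generated_subsemigroup g S' B}"
    (is "?L = ?R")
  proof
    show "?L \<subseteq> ?R"
    proof
      fix m assume "m \<in> ?L"
      then obtain A where m: "m = card A"
        and A: "A \<noteq> {}" "A \<subseteq> S" "finite A" "S = generated_subsemigroup f S A" by blast
      show "m \<in> ?R"
        unfolding m mem_Collect_eq by (rule isomorphic_generating_card[OF S S' bij hom A])
    qed
    show "?R \<subseteq> ?L"
    proof
      fix m assume "m \<in> ?R"
      then obtain B where m: "m = card B"
        and B: "B \<noteq> {}" "B \<subseteq> S'" "finite B" "S' = generated_subsemigroup g S' B" by blast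
      show "m \<in> ?L"
        unfolding m mem_Collect_eq
        by (rule isomorphic_generating_card[OF S' S bij_betw_the_inv_into[OF bij] inv B])
    qed
  qed
  then show ?thesis by (simp add: semigroup_rank_def)
qed

section \<open>Reversing the chain\<close>

definition reversal :: "nat \<Rightarrow> (nat \<Rightarrow> nat) \<Rightarrow> (nat \<Rightarrow> nat)" where
  "reversal n \<alpha> = (\<lambda>x\<in>{1..n}. n + 1 - \<alpha> (n + 1 - x))"

lemma reversal_closed:
  assumes "\<alpha> \<in> order_preserving_maps n"
  shows "reversal n \<alpha> \<in> order_preserving_maps n"
proof -
  have r: "\<alpha> x \<in> {1..n}" if "x \<in> {1..n}" for x
    using assms that unfolding order_preserving_maps_def by blast
  have m: "mono_on {1..n} \<alpha>" using assms by (simp add: order_preserving_maps_def)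
  have "mono_on {1..n} (reversal n \<alpha>)"
    by (rule mono_onI) (auto simp: reversal_def intro!: diff_le_mono2 mono_onD[OF m])
  moreover have "n + 1 - \<alpha> (n + 1 - x) \<in> {1..n}" if "x \<in> {1..n}" for x
  proof -
    have "n + 1 - x \<in> {1..n}" using that by auto
    from r[OF this] show ?thesis by auto
  qed
  then have "reversal n \<alpha> \<in> {1..n} \<rightarrow>\<^sub>E {1..n}"
    by (simp add: reversal_def)
  ultimately show ?thesis by (simp add: order_preserving_maps_def)
qed

lemma reversal_involution:
  assumes "\<alpha> \<in> order_preserving_maps n"
  shows "reversal n (reversal n \<alpha>) = \<alpha>"
proof
  fix x
  show "reversal n (reversal n \<alpha>) x = \<alpha> x"
  proof (cases "x \<in> {1..n}")
    case True
    then have "\<alpha> x \<in> {1..n}" using assms unfolding order_preserving_maps_def by blast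
    then show ?thesis using True by (auto simp: reversal_def)
  next
    case False
    then have "\<alpha> x = undefined"
      using assms unfolding order_preserving_maps_def by blast
    then show ?thesis using False by (auto simp: reversal_def)
  qed
qed

lemma reversal_mult:
  assumes "\<alpha> \<in> order_preserving_maps n"
  shows "reversal n (map_mult n \<alpha> \<beta>) = map_mult n (reversal n \<alpha>) (reversal n \<beta>)"
proof
  fix x
  have "\<alpha> (n + 1 - x) \<in> {1..n}" if "x \<in> {1..n}"
  proof -
    have "n + 1 - x \<in> {1..n}" using that by auto
    then show ?thesis using assms unfolding order_preserving_maps_def by blast
  qed
  then show "reversal n (map_mult n \<alpha> \<beta>) x = map_mult n (reversal n \<alpha>) (reversal n \<beta>) x"
    by (auto simp: reversal_def map_mult_def compose_def)
qed

lemma reversal_const_map: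
  "reversal n (const_map n k) = const_map n (n + 1 - k)"
  by (auto simp: reversal_def const_map_def fun_eq_iff)

lemma reversal_Z:
  assumes "k \<in> {1..n}" "\<alpha> \<in> Z n k"
  shows "reversal n \<alpha> \<in> Z n (n + 1 - k)"
proof -
  let ?k = "n + 1 - k"
  have swap: "reversal n \<beta> \<in> order_preserving_maps n - {const_map n ?k}"
    if "\<beta> \<in> order_preserving_maps n - {const_map n k}" for \<beta>
  proof -
    have "reversal n \<beta> \<noteq> const_map n ?k"
    proof
      assume "reversal n \<beta> = const_map n ?k"
      then have "reversal n (reversal n \<beta>) = const_map n (n + 1 - ?k)"
        by (simp add: reversal_const_map)
      then show False using that assms(1) by (simp add: reversal_involution)
    qed
    then show ?thesis using that reversal_closed by blast
  qed
  obtain \<beta> \<gamma> where \<alpha>: "\<alpha> \<in> order_preserving_maps n"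
    and \<beta>: "\<beta> \<in> order_preserving_maps n - {const_map n k}" "map_mult n \<alpha> \<beta> = const_map n k"
    and \<gamma>: "\<gamma> \<in> order_preserving_maps n - {const_map n k}" "map_mult n \<gamma> \<alpha> = const_map n k"
    using assms(2) unfolding Z_def by blast
  have "map_mult n (reversal n \<alpha>) (reversal n \<beta>) = const_map n ?k"
    using reversal_mult[OF \<alpha>, of \<beta>] \<beta>(2) reversal_const_map by metis
  moreover have "map_mult n (reversal n \<gamma>) (reversal n \<alpha>) = const_map n ?k"
    using reversal_mult[of \<gamma> n \<alpha>] \<gamma> reversal_const_map by (metis DiffD1)
  ultimately show ?thesis
    using swap[OF \<beta>(1)] swap[OF \<gamma>(1)] reversal_closed[OF \<alpha>] unfolding Z_def by blast
qed

lemma subsemigroup_Z_self: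
  assumes "k = 1 \<or> k = n" "n \<ge> 2"
  shows "subsemigroup (map_mult n) (Z n k) (Z n k)"
  using subsemigroup_Z[OF assms] by (auto simp: subsemigroup_def)

lemma semigroup_rank_Z_n:
  assumes "n \<ge> 2"
  shows "semigroup_rank (map_mult n) (Z n n) = semigroup_rank (map_mult n) (Z n 1)"
proof (rule semigroup_rank_isomorphic[symmetric])
  show "subsemigroup (map_mult n) (Z n 1) (Z n 1)" "subsemigroup (map_mult n) (Z n n) (Z n n)"
    using assms by (auto intro: subsemigroup_Z_self)
  have O: "Z n k \<subseteq> order_preserving_maps n" for k by (auto simp: Z_def)
  show "bij_betw (reversal n) (Z n 1) (Z n n)"
  proof (rule bij_betw_byWitness[where f' = "reversal n"])
    show "reversal n ` Z n 1 \<subseteq> Z n n" using reversal_Z[of 1 n] assms by auto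
    show "reversal n ` Z n n \<subseteq> Z n 1" using reversal_Z[of n n] assms by auto
  qed (use O reversal_involution in blast)+
  show "reversal n (map_mult n x y) = map_mult n (reversal n x) (reversal n y)"
    if "x \<in> Z n 1" for x y
    using that O reversal_mult by blast
qed

section \<open>The elements of the semigroup\<close>

text \<open>
  \<open>\<alpha> \<beta> = \<pi>\<^sub>1\<close> with \<open>\<beta> \<noteq> \<pi>\<^sub>1\<close> says that \<open>\<beta>\<close> is \<open>1\<close> up to the maximum \<open>\<alpha> n\<close> of the image of \<open>\<alpha>\<close> but not
  everywhere, which leaves room exactly when \<open>\<alpha> n < n\<close>. Dually, \<open>\<gamma> \<alpha> = \<pi>\<^sub>1\<close> with \<open>\<gamma> \<noteq> \<pi>\<^sub>1\<close> needs a
  point other than \<open>1\<close> in the fibre of \<open>\<alpha>\<close> over \<open>1\<close>, and the fibre is an initial segment.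
\<close>
lemma Z_1_iff:
  assumes n: "n \<ge> 2"
  shows "\<alpha> \<in> Z n 1 \<longleftrightarrow>
    \<alpha> \<in> extensional {1..n} \<and> mono_on {1..n} \<alpha> \<and> \<alpha> 1 = 1 \<and> \<alpha> 2 = 1 \<and> \<alpha> n < n"
    (is "_ \<longleftrightarrow> ?R")
proof
  assume Z: "\<alpha> \<in> Z n 1"
  then obtain \<beta> \<gamma> where \<alpha>: "\<alpha> \<in> order_preserving_maps n"
    and \<beta>: "\<beta> \<in> order_preserving_maps n" "\<beta> \<noteq> const_map n 1" "map_mult n \<alpha> \<beta> = const_map n 1"
    and \<gamma>: "\<gamma> \<in> order_preserving_maps n" "\<gamma> \<noteq> const_map n 1" "map_mult n \<gamma> \<alpha> = const_map n 1"
    unfolding Z_def by blast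
  have r: "f x \<in> {1..n}" if "f \<in> order_preserving_maps n" "x \<in> {1..n}" for f x
    using that unfolding order_preserving_maps_def by blast
  have m: "f x \<le> f y" if "f \<in> order_preserving_maps n" "x \<in> {1..n}" "y \<in> {1..n}" "x \<le> y" for f x y
    using that unfolding order_preserving_maps_def mono_on_def by blast
  have nonconst: "\<exists>x\<in>{1..n}. f x \<noteq> 1" if "f \<in> order_preserving_maps n" "f \<noteq> const_map n 1" for f
  proof (rule ccontr)
    assume "\<not> ?thesis"
    then have "f = const_map n 1"
      using that(1) unfolding order_preserving_maps_def const_map_def
      by (auto simp: fun_eq_iff PiE_def extensional_def)
    then show False using that by simp
  qed
  have \<alpha>1: "\<alpha> 1 = 1" using Z_fixes[OF Z] n by auto
  obtain x where x: "x \<in> {1..n}" "\<gamma> x \<noteq> 1" using nonconst \<gamma> by blast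
  have "\<alpha> (\<gamma> x) = 1"
    using fun_cong[OF \<gamma>(3), of x] x by (simp add: map_mult_def const_map_def compose_def)
  moreover have "\<alpha> 2 \<le> \<alpha> (\<gamma> x)" using m[OF \<alpha>] r[OF \<gamma>(1)] x n
    by (metis (no_types, lifting) atLeastAtMost_iff le_neq_implies_less less_iff_Suc_add
        Suc_1 Suc_leI one_le_numeral)
  ultimately have \<alpha>2: "\<alpha> 2 = 1" using r[OF \<alpha>, of 2] n by auto
  obtain y where y: "y \<in> {1..n}" "\<beta> y \<noteq> 1" using nonconst \<beta> by blast
  have "\<beta> (\<alpha> n) = 1"
    using fun_cong[OF \<beta>(3), of n] n by (simp add: map_mult_def const_map_def compose_def)
  moreover have "\<beta> y \<le> \<beta> n" using m[OF \<beta>(1)] y n by auto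
  ultimately have "\<alpha> n \<noteq> n" using y r[OF \<beta>(1), of y] by auto
  then have "\<alpha> n < n" using r[OF \<alpha>, of n] n by auto
  then show ?R using \<alpha>1 \<alpha>2 \<alpha> by (auto simp: order_preserving_maps_def PiE_def)
next
  assume R: ?R
  then have m: "\<And>x y. 1 \<le> x \<Longrightarrow> x \<le> y \<Longrightarrow> y \<le> n \<Longrightarrow> \<alpha> x \<le> \<alpha> y"
    by (auto simp: mono_on_def)
  have r: "1 \<le> \<alpha> x \<and> \<alpha> x < n" if "x \<in> {1..n}" for x
    using m[of 1 x] m[of x n] R that by auto
  have \<alpha>: "\<alpha> \<in> order_preserving_maps n"
    using R r by (auto simp: order_preserving_maps_def PiE_def less_imp_le)
  \<comment> \<open>This map annihilates \<open>\<alpha>\<close> from both sides: its image is \<open>{1, 2}\<close>, and only \<open>n\<close> goes to \<open>2\<close>.\<close>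
  let ?\<beta> = "\<lambda>x\<in>{1..n}. if x < n then 1 else 2 :: nat"
  have \<beta>: "?\<beta> \<in> order_preserving_maps n"
    using n by (auto simp: order_preserving_maps_def mono_on_def)
  have ne: "?\<beta> \<noteq> const_map n 1"
  proof
    assume "?\<beta> = const_map n 1"
    from fun_cong[OF this, of n] show False using n by (simp add: const_map_def)
  qed
  have "map_mult n \<alpha> ?\<beta> = const_map n 1"
    using r by (fastforce simp: map_mult_def const_map_def compose_def fun_eq_iff)
  moreover have "map_mult n ?\<beta> \<alpha> = const_map n 1"
    using R by (auto simp: map_mult_def const_map_def compose_def fun_eq_iff)
  ultimately show "\<alpha> \<in> Z n 1" using \<alpha> \<beta> ne unfolding Z_def by blast
qed

lemma Z_1D:
  assumes "n \<ge> 2" "\<alpha> \<in> Z n 1"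
  shows "\<alpha> 1 = 1" "\<alpha> 2 = 1" "\<alpha> n < n" "\<alpha> (Suc 0) = Suc 0"
    "\<And>x y. 1 \<le> x \<Longrightarrow> x \<le> y \<Longrightarrow> y \<le> n \<Longrightarrow> \<alpha> x \<le> \<alpha> y"
    "\<And>x. 1 \<le> x \<Longrightarrow> x \<le> n \<Longrightarrow> 1 \<le> \<alpha> x"
    "\<And>x. 1 \<le> x \<Longrightarrow> x \<le> n \<Longrightarrow> \<alpha> x < n"
proof -
  have R: "\<alpha> 1 = 1" "\<alpha> 2 = 1" "\<alpha> n < n" "mono_on {1..n} \<alpha>"
    using Z_1_iff[of n \<alpha>] assms by blast+
  show m: "\<And>x y. 1 \<le> x \<Longrightarrow> x \<le> y \<Longrightarrow> y \<le> n \<Longrightarrow> \<alpha> x \<le> \<alpha> y"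
    using R(4) by (auto simp: mono_on_def)
  show "\<And>x. 1 \<le> x \<Longrightarrow> x \<le> n \<Longrightarrow> 1 \<le> \<alpha> x" using m[of 1] R by auto
  show "\<And>x. 1 \<le> x \<Longrightarrow> x \<le> n \<Longrightarrow> \<alpha> x < n" using m[of _ n] R(3) by (meson le_less_trans order_refl)
  show "\<alpha> 1 = 1" "\<alpha> 2 = 1" "\<alpha> n < n" by (fact R)+
  then show "\<alpha> (Suc 0) = Suc 0" by simp
qed

lemma Z_1_restrictI:
  assumes "n \<ge> 2" "f 1 = 1" "f 2 = 1" "f n < n"
    and step: "\<And>x. 1 \<le> x \<Longrightarrow> x < n \<Longrightarrow> f x \<le> f (Suc x)"
  shows "restrict f {1..n} \<in> Z n 1"
proof -
  have "f x \<le> f y" if "1 \<le> x" "x \<le> y" "y \<le> n" for x y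
    using that(2,1,3)
  proof (induction y rule: dec_induct)
    case (step y)
    then show ?case using assms(5)[of y] by linarith
  qed simp
  then have "mono_on {1..n} (restrict f {1..n})" by (auto simp: mono_on_def)
  then show ?thesis using assms(1-4) unfolding Z_1_iff[OF assms(1)] by simp
qed

lemma Z_1_eqI:
  assumes "n \<ge> 2" "\<alpha> \<in> Z n 1" "\<beta> \<in> Z n 1" "\<And>x. 3 \<le> x \<Longrightarrow> x \<le> n \<Longrightarrow> \<alpha> x = \<beta> x"
  shows "\<alpha> = \<beta>"
proof (rule extensionalityI[of _ "{1..n}"])
  fix x assume x: "x \<in> {1..n}"
  then consider "x = 1" | "x = 2" | "3 \<le> x" by fastforce
  then show "\<alpha> x = \<beta> x"
    using x assms(4) Z_1D(1,2)[OF assms(1,2)] Z_1D(1,2)[OF assms(1,3)] by cases auto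
qed (use Z_1_iff[OF assms(1)] assms(2,3) in blast)+

lemma map_mult_apply: "1 \<le> x \<Longrightarrow> x \<le> n \<Longrightarrow> map_mult n \<alpha> \<beta> x = \<beta> (\<alpha> x)"
  by (simp add: map_mult_def compose_def)

text \<open>
  On \<open>{3..n}\<close> this is the translation that takes \<open>3\<close> to \<open>t\<close>, cut off at the largest admissible value
  \<open>n - 1\<close>. For \<open>t = 2\<close> no cut-off occurs, and the map is \<open>x \<mapsto> x - 1\<close> above \<open>1\<close>.
\<close>
definition ramp :: "nat \<Rightarrow> nat \<Rightarrow> (nat \<Rightarrow> nat)" where
  "ramp n t = (\<lambda>x\<in>{1..n}. if x \<le> 2 then 1 else min (t + x - 3) (n - 1))"

text \<open>
  For \<open>3 \<le> j < n\<close> the kernel classes are \<open>{1, 2}\<close>, \<open>{j, j + 1}\<close> and singletons, and the image is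
  \<open>{1..n - 1} - {2}\<close>.
\<close>
definition fuse :: "nat \<Rightarrow> nat \<Rightarrow> (nat \<Rightarrow> nat)" where
  "fuse n j = (\<lambda>x\<in>{1..n}. if x \<le> 2 then 1 else if x \<le> j then x else x - 1)"

text \<open>
  For \<open>2 \<le> c \<le> n - 2\<close> the kernel classes are \<open>{1, 2}\<close>, \<open>{n - 1, n}\<close> and singletons, and the image
  is \<open>{1..n - 1} - {c}\<close>.
\<close>
definition skip :: "nat \<Rightarrow> nat \<Rightarrow> (nat \<Rightarrow> nat)" where
  "skip n c = (\<lambda>x\<in>{1..n}. if x \<le> 1 then 1 else if x \<le> c then x - 1 else min x (n - 1))"

lemma ramp_in_Z: "n \<ge> 3 \<Longrightarrow> t \<ge> 1 \<Longrightarrow> ramp n t \<in> Z n 1"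
  unfolding ramp_def by (rule Z_1_restrictI) auto

lemma fuse_in_Z: "3 \<le> j \<Longrightarrow> j < n \<Longrightarrow> fuse n j \<in> Z n 1"
  unfolding fuse_def by (rule Z_1_restrictI) auto

lemma skip_in_Z: "2 \<le> c \<Longrightarrow> c < n \<Longrightarrow> skip n c \<in> Z n 1"
  unfolding skip_def by (rule Z_1_restrictI) auto

section \<open>Indispensable elements\<close>

lemma strict_growth:
  fixes f :: "nat \<Rightarrow> nat"
  assumes "\<And>x. a \<le> x \<Longrightarrow> x < b \<Longrightarrow> f x < f (Suc x)" "a \<le> y" "y \<le> z" "z \<le> b"
  shows "f y + (z - y) \<le> f z"
  using assms(3,2,4)
proof (induction z rule: dec_induct)
  case (step z)
  then show ?case using assms(1)[of z] by fastforce
qed simp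

text \<open>
  The product is injective on \<open>{2..n}\<close>, hence so is \<open>\<beta>\<close>; a strictly increasing map of these
  \<open>n - 1\<close> points into \<open>{1..n - 1}\<close> is unique.
\<close>
lemma ramp_2_left_factor:
  assumes n: "n \<ge> 3" and Z: "\<beta> \<in> Z n 1" "\<gamma> \<in> Z n 1"
    and eq: "ramp n 2 = map_mult n \<beta> \<gamma>"
  shows "\<beta> = ramp n 2"
proof -
  have n2: "n \<ge> 2" using n by simp
  note B = Z_1D[OF n2 Z(1)] and C = Z_1D[OF n2 Z(2)]
  have val: "\<gamma> (\<beta> x) = x - 1" if "2 \<le> x" "x \<le> n" for x
    using fun_cong[OF eq, of x] that by (auto simp: map_mult_apply ramp_def min_def split: if_splits)
  have inc: "\<beta> x < \<beta> (Suc x)" if "2 \<le> x" "x < n" for x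
    using val[of x] val[of "Suc x"] B(5)[of x "Suc x"] that by (cases "\<beta> x = \<beta> (Suc x)") auto
  show ?thesis
  proof (rule Z_1_eqI[OF n2 Z(1) ramp_in_Z])
    fix x assume x: "3 \<le> x" "x \<le> n"
    have "\<beta> 2 + (x - 2) \<le> \<beta> x" "\<beta> x + (n - x) \<le> \<beta> n"
      using strict_growth[of 2 n \<beta>] inc x by auto
    then show "\<beta> x = ramp n 2 x" using B(2,3) x by (simp add: ramp_def)
  qed (use n in auto)
qed

text \<open>
  The image of \<open>\<beta>\<close> on \<open>{3..n}\<close> lies in \<open>{3..n - 1}\<close>, because \<open>\<gamma>\<close> sends \<open>1\<close> and \<open>2\<close> to \<open>1\<close> while
  \<open>\<alpha> 3 \<noteq> 1\<close>. So \<open>\<beta>\<close> must identify two neighbours, and \<open>\<alpha>\<close> permits this only at \<open>j\<close>; everywhere else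
  the bounds at both ends determine \<open>\<beta>\<close>. It is stated for any product \<open>\<alpha>\<close> of this shape, since it
  applies both to \<open>fuse n j\<close> itself and, with \<open>j = n - 1\<close>, to the maps \<open>skip n c\<close>.
\<close>
lemma left_factor_eq_fuse:
  assumes n: "3 \<le> j" "j < n" and Z: "\<beta> \<in> Z n 1" "\<gamma> \<in> Z n 1"
    and \<alpha>: "\<alpha> = map_mult n \<beta> \<gamma>" "\<alpha> 3 \<noteq> 1"
    and inc: "\<And>x. 3 \<le> x \<Longrightarrow> x < n \<Longrightarrow> x \<noteq> j \<Longrightarrow> \<alpha> x < \<alpha> (Suc x)"
  shows "\<beta> = fuse n j"
proof -
  have n2: "n \<ge> 2" using n by simp
  note B = Z_1D[OF n2 Z(1)] and C = Z_1D[OF n2 Z(2)]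
  have val: "\<gamma> (\<beta> x) = \<alpha> x" if "1 \<le> x" "x \<le> n" for x
    using that \<alpha> by (auto simp: map_mult_apply)
  have "\<beta> 3 \<noteq> 1" "\<beta> 3 \<noteq> 2" using val[of 3] \<alpha>(2) C n by auto
  then have b3: "\<beta> 3 \<ge> 3" using B(6)[of 3] n by auto
  have binc: "\<beta> x < \<beta> (Suc x)" if "3 \<le> x" "x < n" "x \<noteq> j" for x
    using val[of x] val[of "Suc x"] B(5)[of x "Suc x"] inc[OF that] that
    by (cases "\<beta> x = \<beta> (Suc x)") auto
  have low: "x \<le> \<beta> x" if "3 \<le> x" "x \<le> j" for x
    using strict_growth[of 3 j \<beta> 3 x] binc that n b3 by auto
  have high: "\<beta> x < x" if "j < x" "x \<le> n" for x
    using strict_growth[of "Suc j" n \<beta> x n] binc that n B(3) by auto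
  have up: "\<beta> x \<le> x" if "3 \<le> x" "x \<le> j" for x
    using strict_growth[of 3 j \<beta> x j] binc that n B(5)[of j "Suc j"] high[of "Suc j"] by auto
  have dn: "x \<le> Suc (\<beta> x)" if "j < x" "x \<le> n" for x
    using strict_growth[of "Suc j" n \<beta> "Suc j" x] binc that n B(5)[of j "Suc j"] low[of j] by auto
  show ?thesis
  proof (rule Z_1_eqI[OF n2 Z(1) fuse_in_Z[OF n]])
    fix x assume x: "3 \<le> x" "x \<le> n"
    show "\<beta> x = fuse n j x"
      using low[of x] high[of x] up[of x] dn[of x] x by (cases "x \<le> j") (auto simp: fuse_def)
  qed
qed

lemma fuse_left_factor:
  assumes "3 \<le> j" "j < n" "\<beta> \<in> Z n 1" "\<gamma> \<in> Z n 1" "fuse n j = map_mult n \<beta> \<gamma>"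
  shows "\<beta> = fuse n j"
proof (rule left_factor_eq_fuse[OF assms])
  show "fuse n j 3 \<noteq> 1" using assms(1,2) by (simp add: fuse_def)
  show "fuse n j x < fuse n j (Suc x)" if "3 \<le> x" "x < n" "x \<noteq> j" for x
    using assms(1,2) that by (auto simp: fuse_def)
qed

text \<open>
  The left factor can only be \<open>fuse n (n - 1)\<close>, which is the identity on \<open>{3..n - 1}\<close>. So \<open>\<gamma>\<close> agrees with
  the product there, and its value at \<open>n\<close> is squeezed between \<open>\<gamma> (n - 1) = n - 1\<close> and \<open>n - 1\<close>.
\<close>
lemma skip_right_factor:
  assumes c: "3 \<le> c" "c \<le> n - 2" and Z: "\<beta> \<in> Z n 1" "\<gamma> \<in> Z n 1"
    and eq: "skip n c = map_mult n \<beta> \<gamma>"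
  shows "\<gamma> = skip n c"
proof -
  have n2: "n \<ge> 2" using c by simp
  note C = Z_1D[OF n2 Z(2)]
  have \<beta>: "\<beta> = fuse n (n - 1)"
    by (rule left_factor_eq_fuse[OF _ _ Z eq]) (use c in \<open>auto simp: skip_def\<close>)
  have val: "\<gamma> x = skip n c x" if "3 \<le> x" "x < n" for x
  proof -
    have "x \<le> n - 1" using that by simp
    then show ?thesis using fun_cong[OF eq, of x] that by (simp add: map_mult_apply \<beta> fuse_def)
  qed
  show ?thesis
  proof (rule Z_1_eqI[OF n2 Z(2) skip_in_Z])
    fix x assume x: "3 \<le> x" "x \<le> n"
    show "\<gamma> x = skip n c x"
    proof (cases "x < n")
      case False
      then have "x = n" using x by simp
      moreover have "skip n c (n - 1) = n - 1" using c by (auto simp: skip_def)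
      then have "n - 1 \<le> \<gamma> n" using val[of "n - 1"] C(5)[of "n - 1" n] c by simp
      moreover have "skip n c n = n - 1" using c by (auto simp: skip_def)
      ultimately show ?thesis using C(3) by simp
    qed (use val x in auto)
  qed (use c in auto)
qed

section \<open>Generation\<close>

text \<open>
  The range of \<open>c\<close> avoids repetitions: \<open>skip n 2 = fuse n (n - 1)\<close> and \<open>skip n (n - 1) = ramp n 2\<close>.
\<close>
definition indispensable :: "nat \<Rightarrow> (nat \<Rightarrow> nat) set" where
  "indispensable n = insert (ramp n 2) (fuse n ` {3..n - 1} \<union> skip n ` {3..n - 2})"

lemma indispensable_subset_Z: "n \<ge> 5 \<Longrightarrow> indispensable n \<subseteq> Z n 1"
  unfolding indispensable_def by (auto intro!: ramp_in_Z fuse_in_Z skip_in_Z simp del: One_nat_def)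

lemma indispensable_at_3:
  assumes "n \<ge> 5" "\<alpha> \<in> indispensable n"
  shows "\<alpha> 3 \<le> 3"
  using assms by (auto simp: indispensable_def ramp_def fuse_def skip_def)

lemma card_indispensable:
  assumes n: "n \<ge> 5"
  shows "card (indispensable n) = 2 * n - 6"
proof -
  have "inj_on (fuse n) {3..n - 1}"
  proof (rule linorder_inj_onI)
    fix i j assume "i < j" "i \<in> {3..n - 1}" "j \<in> {3..n - 1}"
    then have "fuse n i (Suc i) \<noteq> fuse n j (Suc i)" by (auto simp: fuse_def)
    then show "fuse n i \<noteq> fuse n j" by metis
  qed auto
  then have f: "card (fuse n ` {3..n - 1}) = n - 3" by (simp add: card_image)
  have "inj_on (skip n) {3..n - 2}"
  proof (rule linorder_inj_onI)
    fix i j assume "i < j" "i \<in> {3..n - 2}" "j \<in> {3..n - 2}"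
    then have "skip n i j \<noteq> skip n j j" by (auto simp: skip_def)
    then show "skip n i \<noteq> skip n j" by metis
  qed auto
  then have s: "card (skip n ` {3..n - 2}) = n - 4" by (simp add: card_image)
  have "fuse n j 3 \<noteq> skip n c 3" if "3 \<le> j" "3 \<le> c" for j c
    using that n by (auto simp: fuse_def skip_def)
  then have "fuse n ` {3..n - 1} \<inter> skip n ` {3..n - 2} = {}"
    by (auto simp: image_def) metis
  then have u: "card (fuse n ` {3..n - 1} \<union> skip n ` {3..n - 2}) = (n - 3) + (n - 4)"
    by (subst card_Un_disjoint) (use f s in auto)
  have "ramp n 2 3 \<noteq> fuse n j 3" if "3 \<le> j" for j
    using that n by (auto simp: fuse_def ramp_def)
  moreover have "ramp n 2 (n - 1) \<noteq> skip n c (n - 1)" if "c \<le> n - 2" for c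
    using that n by (auto simp: skip_def ramp_def)
  ultimately have "ramp n 2 \<notin> fuse n ` {3..n - 1} \<union> skip n ` {3..n - 2}"
    by (auto simp: image_def) metis+
  then show ?thesis using u n by (simp add: indispensable_def)
qed

lemma ramp_4_notin_indispensable: "n \<ge> 5 \<Longrightarrow> ramp n 4 \<notin> indispensable n"
  using indispensable_at_3[of n "ramp n 4"] by (auto simp: ramp_def)

text \<open>
  There are three ways to split off a generator. If \<open>\<alpha> 3 = 1\<close>, then \<open>ramp n 2\<close> splits off on the
  left. If \<open>\<alpha>\<close> is constant on a pair \<open>{j, j + 1}\<close> at a value below \<open>n - 1\<close>, then \<open>fuse n j\<close> splits off on
  the left. In both cases the other factor takes the values of \<open>\<alpha>\<close> one step earlier (in the second
  case from \<open>j\<close> on) and has a free value at \<open>n\<close>, which is put to \<open>n - 1\<close>. If the image of \<open>\<alpha>\<close> has a gap \<open>c\<close> between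
  \<open>\<alpha> 3\<close> and \<open>n - 1\<close>, then \<open>skip n c\<close> splits off on the right, and the other factor has the values
  strictly between \<open>1\<close> and the gap raised by one. A map to which none of this applies increases on \<open>{3..n}\<close> by single
  steps until it reaches \<open>n - 1\<close>, so it is \<open>ramp n (\<alpha> 3)\<close>.
\<close>
lemma larger_factor:
  assumes n: "n \<ge> 5" and \<alpha>: "\<alpha> \<in> Z n 1" and not_ramp: "\<alpha> \<notin> ramp n ` {2..n - 1}"
  shows "\<exists>g\<in>indispensable n. \<exists>\<gamma>\<in>Z n 1. (\<forall>x\<in>{1..n}. \<alpha> x \<le> \<gamma> x) \<and> \<gamma> \<noteq> \<alpha> \<and>
    (\<alpha> = map_mult n g \<gamma> \<or> \<alpha> = map_mult n \<gamma> g)"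
proof -
  have n2: "n \<ge> 2" using n by simp
  note A = Z_1D[OF n2 \<alpha>]
  have mult: "map_mult n \<beta> \<gamma> \<in> Z n 1" if "\<beta> \<in> Z n 1" "\<gamma> \<in> Z n 1" for \<beta> \<gamma>
    using Z_mult_closed[of 1 n \<beta> \<gamma>] that n by simp
  consider
      (one) "\<alpha> 3 = 1"
    | (level) j where "3 \<le> j" "j < n" "\<alpha> j = \<alpha> (Suc j)" "\<alpha> j < n - 1"
    | (gap) c where "2 \<le> \<alpha> 3" "\<alpha> 3 < c" "c \<le> n - 2" "c \<notin> \<alpha> ` {1..n}"
    | (none) "2 \<le> \<alpha> 3" "\<And>j. 3 \<le> j \<Longrightarrow> j < n \<Longrightarrow> \<alpha> j < n - 1 \<Longrightarrow> \<alpha> j \<noteq> \<alpha> (Suc j)"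
        "\<And>c. \<alpha> 3 < c \<Longrightarrow> c \<le> n - 2 \<Longrightarrow> c \<in> \<alpha> ` {1..n}"
    using A(6)[of 3] n by fastforce
  then show ?thesis
  proof cases
    case one
    let ?\<gamma> = "\<lambda>x\<in>{1..n}. if x < n then \<alpha> (Suc x) else n - 1"
    have \<gamma>: "?\<gamma> \<in> Z n 1"
    proof (rule Z_1_restrictI)
      fix x assume x: "1 \<le> x" "x < n"
      then show "(if x < n then \<alpha> (Suc x) else n - 1)
        \<le> (if Suc x < n then \<alpha> (Suc (Suc x)) else n - 1)"
        using A(5)[of "Suc x" "Suc (Suc x)"] A(7)[of "Suc x"] by auto
    qed (use n one A in \<open>auto simp: numeral_3_eq_3 numeral_2_eq_2\<close>)
    have g: "ramp n 2 \<in> Z n 1" "ramp n 2 \<in> indispensable n"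
      using ramp_in_Z[of n 2] n by (auto simp: indispensable_def)
    have "\<alpha> = map_mult n (ramp n 2) ?\<gamma>"
      by (rule Z_1_eqI[OF n2 \<alpha> mult[OF g(1) \<gamma>]])
        (use n in \<open>auto simp: map_mult_apply ramp_def\<close>)
    moreover have "\<forall>x\<in>{1..n}. \<alpha> x \<le> ?\<gamma> x"
    proof
      fix x assume "x \<in> {1..n}"
      then show "\<alpha> x \<le> ?\<gamma> x" using A(5)[of x "Suc x"] A(7)[of x] by auto
    qed
    moreover have "?\<gamma> \<noteq> \<alpha>"
    proof
      assume eq: "?\<gamma> = \<alpha>"
      \<comment> \<open>If nothing had increased, \<open>\<alpha>\<close> would be constant, contrary to the free value at \<open>n\<close>.\<close>
      have "\<alpha> x = 1" if "1 \<le> x" "x \<le> n" for x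
        using that
      proof (induction x rule: dec_induct)
        case (step x)
        then show ?case using fun_cong[OF eq, of x] by auto
      qed (use A in auto)
      then show False using fun_cong[OF eq, of n] n by auto
    qed
    ultimately show ?thesis using g \<gamma> by blast
  next
    case level
    let ?\<gamma> = "\<lambda>x\<in>{1..n}. if x < j then \<alpha> x else if x < n then \<alpha> (Suc x) else n - 1"
    have \<gamma>: "?\<gamma> \<in> Z n 1"
    proof (rule Z_1_restrictI)
      fix x assume x: "1 \<le> x" "x < n"
      then show "(if x < j then \<alpha> x else if x < n then \<alpha> (Suc x) else n - 1)
        \<le> (if Suc x < j then \<alpha> (Suc x) else if Suc x < n then \<alpha> (Suc (Suc x)) else n - 1)"
        using A(5)[of x "Suc x"] A(5)[of "Suc x" "Suc (Suc x)"] A(5)[of x "Suc (Suc x)"]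
          A(7)[of x] A(7)[of "Suc x"] level by auto
    qed (use level A in auto)
    have g: "fuse n j \<in> Z n 1" "fuse n j \<in> indispensable n"
      using fuse_in_Z[of j n] level by (auto simp: indispensable_def)
    have "\<alpha> = map_mult n (fuse n j) ?\<gamma>"
      by (rule Z_1_eqI[OF n2 \<alpha> mult[OF g(1) \<gamma>]])
        (use level in \<open>auto simp: map_mult_apply fuse_def not_le le_less\<close>)
    moreover have "\<forall>x\<in>{1..n}. \<alpha> x \<le> ?\<gamma> x"
    proof
      fix x assume "x \<in> {1..n}"
      then show "\<alpha> x \<le> ?\<gamma> x" using A(5)[of x "Suc x"] A(7)[of x] by auto
    qed
    moreover have "?\<gamma> \<noteq> \<alpha>"
    proof
      assume eq: "?\<gamma> = \<alpha>"
      \<comment> \<open>If nothing had increased, \<open>\<alpha>\<close> would be constant from \<open>j\<close> on, so its value at \<open>n\<close>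
        would be below the free value \<open>n - 1\<close>.\<close>
      have "\<alpha> x < n - 1" if "j \<le> x" "x \<le> n" for x
        using that
      proof (induction x rule: dec_induct)
        case (step x)
        then show ?case using fun_cong[OF eq, of x] level by auto
      qed (use level in auto)
      then have "\<alpha> n < n - 1" using level by simp
      then show False using fun_cong[OF eq, of n] level by simp
    qed
    ultimately show ?thesis using g \<gamma> by blast
  next
    case gap
    let ?f = "\<lambda>x. if 2 \<le> \<alpha> x \<and> \<alpha> x < c then Suc (\<alpha> x) else \<alpha> x"
    let ?\<gamma> = "restrict ?f {1..n}"
    have \<gamma>: "?\<gamma> \<in> Z n 1"
    proof (rule Z_1_restrictI)
      fix x assume x: "1 \<le> x" "x < n"
      have "\<alpha> (Suc x) \<noteq> c" using gap x by auto
      then show "?f x \<le> ?f (Suc x)" using A(5)[of x "Suc x"] x by auto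
    qed (use A gap in auto)
    have g: "skip n c \<in> Z n 1" "skip n c \<in> indispensable n"
      using skip_in_Z[of c n] n gap by (auto simp: indispensable_def)
    have "\<alpha> = map_mult n ?\<gamma> (skip n c)"
    proof (rule Z_1_eqI[OF n2 \<alpha> mult[OF \<gamma> g(1)]])
      fix x assume x: "3 \<le> x" "x \<le> n"
      have "\<alpha> x \<noteq> c" "1 \<le> \<alpha> x" "\<alpha> x < n" using gap x A(6,7) by auto
      then show "\<alpha> x = map_mult n ?\<gamma> (skip n c) x"
        using x gap by (auto simp: map_mult_apply skip_def)
    qed
    moreover have "\<forall>x\<in>{1..n}. \<alpha> x \<le> ?\<gamma> x" by auto
    moreover have "?\<gamma> \<noteq> \<alpha>"
    proof
      assume "?\<gamma> = \<alpha>"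
      from fun_cong[OF this, of 3] show False using gap n by auto
    qed
    ultimately show ?thesis using g \<gamma> by blast
  next
    case none
    have suc: "\<alpha> (Suc x) = Suc (\<alpha> x)" if x: "3 \<le> x" "x < n" "\<alpha> x < n - 1" for x
    proof (rule ccontr)
      assume ne: "\<alpha> (Suc x) \<noteq> Suc (\<alpha> x)"
      have "\<alpha> x < \<alpha> (Suc x)" using none(2)[OF x] A(5)[of x "Suc x"] x by auto
      then have big: "Suc (\<alpha> x) < \<alpha> (Suc x)" using ne by simp
      have "\<alpha> 3 \<le> \<alpha> x" "\<alpha> (Suc x) < n" using A(5)[of 3 x] A(7)[of "Suc x"] x by auto
      then have "Suc (\<alpha> x) \<in> \<alpha> ` {1..n}" using none(3)[of "Suc (\<alpha> x)"] big by auto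
      then obtain y where y: "1 \<le> y" "y \<le> n" "\<alpha> y = Suc (\<alpha> x)" by auto
      then show False
        using A(5)[of y x] A(5)[of "Suc x" y] big x by (cases "y \<le> x") auto
    qed
    have val: "\<alpha> x = min (\<alpha> 3 + x - 3) (n - 1)" if "3 \<le> x" "x \<le> n" for x
      using that
    proof (induction x rule: dec_induct)
      case base
      then show ?case using A(7)[of 3] n by auto
    next
      case (step x)
      then show ?case
        using suc[of x] A(5)[of x "Suc x"] A(7)[of "Suc x"] by (cases "\<alpha> x < n - 1") auto
    qed
    have "\<alpha> = ramp n (\<alpha> 3)"
    proof (rule Z_1_eqI[OF n2 \<alpha> ramp_in_Z])
      fix x assume x: "3 \<le> x" "x \<le> n"
      show "\<alpha> x = ramp n (\<alpha> 3) x" unfolding val[OF x] using x by (simp add: ramp_def)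
    qed (use n none(1) in auto)
    moreover have "\<alpha> 3 \<in> {2..n - 1}" using none(1) A(7)[of 3] n by auto
    ultimately show ?thesis using not_ramp by blast
  qed
qed

lemma ramp_Suc:
  assumes n: "n \<ge> 5" and t: "t \<ge> 3"
  shows "ramp n (Suc t) = map_mult n (ramp n t) (ramp n 4)"
proof (rule Z_1_eqI[of n])
  show "ramp n (Suc t) \<in> Z n 1" using n t by (intro ramp_in_Z) auto
  show "map_mult n (ramp n t) (ramp n 4) \<in> Z n 1"
    by (intro Z_mult_closed ramp_in_Z) (use n t in auto)
  show "ramp n (Suc t) x = map_mult n (ramp n t) (ramp n 4) x" if "3 \<le> x" "x \<le> n" for x
    using that n t by (auto simp: map_mult_apply ramp_def min_def)
qed (use n in simp)

lemma ramp_3: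
  assumes n: "n \<ge> 5"
  shows "ramp n 3 = fuse n (n - 1)"
proof (rule Z_1_eqI[of n])
  show "ramp n 3 \<in> Z n 1" "fuse n (n - 1) \<in> Z n 1"
    using n by (auto intro!: ramp_in_Z fuse_in_Z simp del: One_nat_def)
  show "ramp n 3 x = fuse n (n - 1) x" if "3 \<le> x" "x \<le> n" for x
    using that n by (auto simp: ramp_def fuse_def)
qed (use n in simp)

lemma indispensable_ramp_4_generates:
  assumes n: "n \<ge> 5" and T: "insert (ramp n 4) (indispensable n) \<subseteq> T"
    and closed: "\<forall>x\<in>T. \<forall>y\<in>T. map_mult n x y \<in> T" and \<alpha>: "\<alpha> \<in> Z n 1"
  shows "\<alpha> \<in> T"
proof -
  have indispensable: "g \<in> T" if "g \<in> indispensable n" for g using that T by auto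
  have "ramp n t \<in> T" if "3 \<le> t" for t
    using that
  proof (induction t rule: dec_induct)
    case base
    show ?case using n indispensable by (auto simp: ramp_3 indispensable_def)
  next
    case (step t)
    then show ?case using n closed T by (auto simp: ramp_Suc)
  qed
  moreover have "ramp n 2 \<in> T" using indispensable by (simp add: indispensable_def)
  ultimately have ramps: "ramp n t \<in> T" if "2 \<le> t" for t
    using that by (cases "t = 2") auto
  show ?thesis
    \<comment> \<open>Passing to a pointwise larger map makes this sum smaller.\<close>
    using \<alpha>
  proof (induction "\<Sum>x\<in>{1..n}. n - \<alpha> x" arbitrary: \<alpha> rule: less_induct)
    case less
    show ?case
    proof (cases "\<alpha> \<in> ramp n ` {2..n - 1}")
      case True
      then show ?thesis using ramps by auto
    next
      case False
      obtain g \<gamma> where g: "g \<in> indispensable n" and \<gamma>: "\<gamma> \<in> Z n 1"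
        and ge: "\<forall>x\<in>{1..n}. \<alpha> x \<le> \<gamma> x" and ne: "\<gamma> \<noteq> \<alpha>"
        and prod: "\<alpha> = map_mult n g \<gamma> \<or> \<alpha> = map_mult n \<gamma> g"
        using larger_factor[OF n less.prems False] by blast
      have n2: "n \<ge> 2" using n by simp
      obtain x where x: "3 \<le> x" "x \<le> n" "\<gamma> x \<noteq> \<alpha> x"
        using Z_1_eqI[OF n2 \<gamma> less.prems] ne by blast
      have "(\<Sum>x\<in>{1..n}. n - \<gamma> x) < (\<Sum>x\<in>{1..n}. n - \<alpha> x)"
      proof (rule sum_strict_mono_ex1)
        show "\<exists>x\<in>{1..n}. n - \<gamma> x < n - \<alpha> x"
        proof
          have "\<alpha> x \<le> \<gamma> x" using ge x by simp
          then show "n - \<gamma> x < n - \<alpha> x" using x Z_1D(7)[OF n2 \<gamma>, of x] by simp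
          show "x \<in> {1..n}" using x by simp
        qed
      qed (use ge in auto)
      then have "\<gamma> \<in> T" using less.hyps \<gamma> by blast
      then show ?thesis using prod closed indispensable[OF g] by auto
    qed
  qed
qed

section \<open>The rank\<close>

lemma generating_set_contains_indispensable:
  assumes n: "n \<ge> 5" and A: "A \<noteq> {}" "A \<subseteq> Z n 1"
    and gen: "Z n 1 = generated_subsemigroup (map_mult n) (Z n 1) A"
  shows "indispensable n \<subseteq> A"
proof
  fix g assume g: "g \<in> indispensable n"
  have S: "subsemigroup (map_mult n) (Z n 1) (Z n 1)" using n by (auto intro: subsemigroup_Z_self)
  have prime: "\<beta> = g \<or> \<gamma> = g" if "\<beta> \<in> Z n 1" "\<gamma> \<in> Z n 1" "map_mult n \<beta> \<gamma> = g" for \<beta> \<gamma>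
  proof -
    consider "g = ramp n 2" | j where "3 \<le> j" "j < n" "g = fuse n j"
      | c where "3 \<le> c" "c \<le> n - 2" "g = skip n c"
      using g n by (auto simp: indispensable_def)
    then show ?thesis
    proof cases
      case 1
      then show ?thesis using ramp_2_left_factor[of n \<beta> \<gamma>] that n by simp
    next
      case 2
      then show ?thesis using fuse_left_factor[of j n \<beta> \<gamma>] that by simp
    next
      case 3
      then show ?thesis using skip_right_factor[of c n \<beta> \<gamma>] that by simp
    qed
  qed
  show "g \<in> A"
  proof (rule ccontr)
    assume "g \<notin> A"
    then have "A \<subseteq> Z n 1 - {g}" using A by auto
    moreover have "\<forall>x\<in>Z n 1 - {g}. \<forall>y\<in>Z n 1 - {g}. map_mult n x y \<in> Z n 1 - {g}"
      using prime S unfolding subsemigroup_def by blast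
    ultimately have "Z n 1 - {g} = Z n 1"
      using gen unfolding generated_eq_iff[OF S A] by blast
    then show False using g indispensable_subset_Z[OF n] by blast
  qed
qed

text \<open>
  Order-preserving maps that send \<open>3\<close> to at most \<open>3\<close> are closed under products, and \<open>ramp n 4\<close> is not
  among them.
\<close>
lemma generating_set_lifts_3:
  assumes n: "n \<ge> 5" and A: "A \<noteq> {}" "A \<subseteq> Z n 1"
    and gen: "Z n 1 = generated_subsemigroup (map_mult n) (Z n 1) A"
  shows "\<exists>\<alpha>\<in>A. 3 < \<alpha> 3"
proof (rule ccontr)
  assume no: "\<not> ?thesis"
  have n2: "n \<ge> 2" using n by simp
  have S: "subsemigroup (map_mult n) (Z n 1) (Z n 1)" using n by (auto intro: subsemigroup_Z_self)
  let ?T = "{\<alpha> \<in> Z n 1. \<alpha> 3 \<le> 3}"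
  have "map_mult n \<beta> \<gamma> 3 \<le> 3" if "\<beta> \<in> ?T" "\<gamma> \<in> ?T" for \<beta> \<gamma>
  proof -
    have "1 \<le> \<beta> 3" "\<beta> 3 \<le> 3" using that Z_1D(6)[OF n2, of \<beta> 3] n by auto
    then have "\<gamma> (\<beta> 3) \<le> \<gamma> 3" using that Z_1D(5)[OF n2, of \<gamma> "\<beta> 3" 3] n by auto
    then show ?thesis using that n by (auto simp: map_mult_apply)
  qed
  then have "\<forall>x\<in>?T. \<forall>y\<in>?T. map_mult n x y \<in> ?T"
    using S by (auto simp: subsemigroup_def)
  moreover have "A \<subseteq> ?T" using A no by force
  ultimately have "?T = Z n 1" using gen unfolding generated_eq_iff[OF S A] by blast
  moreover have "ramp n 4 \<in> Z n 1" using n by (intro ramp_in_Z) auto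
  ultimately have "ramp n 4 3 \<le> 3" by blast
  then show False using n by (simp add: ramp_def)
qed

lemma semigroup_rank_Z_1:
  assumes n: "n \<ge> 5"
  shows "semigroup_rank (map_mult n) (Z n 1) = 2 * n - 5"
  unfolding semigroup_rank_def
proof (rule cInf_eq_minimum)
  let ?A = "insert (ramp n 4) (indispensable n)"
  have S: "subsemigroup (map_mult n) (Z n 1) (Z n 1)" using n by (auto intro: subsemigroup_Z_self)
  have fin: "finite (indispensable n)" by (simp add: indispensable_def)
  have A: "?A \<noteq> {}" "?A \<subseteq> Z n 1" using indispensable_subset_Z[OF n] ramp_in_Z[of n 4] n by auto
  have "Z n 1 = generated_subsemigroup (map_mult n) (Z n 1) ?A"
    unfolding generated_eq_iff[OF S A] using indispensable_ramp_4_generates[OF n] by blast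
  moreover have "card ?A = 2 * n - 5"
    using fin card_indispensable[OF n] ramp_4_notin_indispensable[OF n] n by simp
  ultimately show "2 * n - 5 \<in> {card A |A. A \<noteq> {} \<and> A \<subseteq> Z n 1 \<and> finite A \<and>
      Z n 1 = generated_subsemigroup (map_mult n) (Z n 1) A}"
    using A fin by (intro CollectI exI[of _ ?A]) auto
next
  fix m assume "m \<in> {card A |A. A \<noteq> {} \<and> A \<subseteq> Z n 1 \<and> finite A \<and>
      Z n 1 = generated_subsemigroup (map_mult n) (Z n 1) A}"
  then obtain A where m: "m = card A" and A: "A \<noteq> {}" "A \<subseteq> Z n 1" and fin: "finite A"
    and gen: "Z n 1 = generated_subsemigroup (map_mult n) (Z n 1) A" by blast
  obtain \<alpha> where \<alpha>: "\<alpha> \<in> A" "3 < \<alpha> 3" using generating_set_lifts_3[OF n A gen] by blast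
  have "\<alpha> \<notin> indispensable n" using indispensable_at_3[OF n] \<alpha>(2) by fastforce
  moreover have "insert \<alpha> (indispensable n) \<subseteq> A"
    using generating_set_contains_indispensable[OF n A gen] \<alpha> by auto
  ultimately show "2 * n - 5 \<le> m"
    using card_mono[OF fin, of "insert \<alpha> (indispensable n)"] card_indispensable[OF n] n m
    by (simp add: indispensable_def)
qed

theorem theorem14:
  fixes n :: nat
  assumes "n \<ge> 5"
  shows "semigroup_rank (map_mult n) (Z n 1) = 2 * n - 5 \<and>
         semigroup_rank (map_mult n) (Z n n) = 2 * n - 5"
  using semigroup_rank_Z_1[OF assms] semigroup_rank_Z_n[of n] assms by simp

end
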